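(* Let $\kappa$ be a regular uncountable cardinal and let $\theta\le\kappa$ be a (possibly finite) cardinal. If $\mathrm{P}\ell_1(\kappa)$ holds, then the following are equivalent: (1) There exists a coloring $c:[\kappa]^2\rightarrow\theta$ such that, for every $X\subseteq\kappa$ of size $\kappa$ and every $\tau\in\theta$, there exist $x\neq y$ in $X$ such that $c(x,y)=\tau$ (where the pair is listed in increasing order); (2) For every Abelian group $(G,+)$ of size $\kappa$, there exists a coloring $c:G\rightarrow\theta$ such that, for all $X,Y\subseteq G$ of size $\kappa$ and every $\tau\in\theta$, there exist $x\in X$ and $y\in Y$ such that $c(x+y)=\tau$.
   Context: $[\kappa]^2:=\{(\alpha,\beta)\mid \alpha<\beta<\kappa\}$. For sets of ordinals $a,b$, write $a<b$ iff $\alpha<\beta$ for all $\alpha\in a$ and $\beta\in b$. $\mathrm{P}\ell_1(\kappa)$ asserts the existence of a transformation $\mathbf t:[\kappa]^2\rightarrow[\kappa]^2$ satisfying the following: - for every $(\alpha,\beta)\in[\kappa]^2$, if $\mathbf t(\alpha,\beta)=(\alpha^*,\beta^* )$, then $\alpha^*\le\alpha<\beta^*\le\beta$; - for every family $\mathcal A$ consisting of $\kappa$ many pairwise disjoint finite subsets of $\kappa$, there exists a stationary $S\subseteq\kappa$ such that, for every pair $\alpha^*<\beta^*$ of elements of $S$, there exists a pair $a<b$ of elements of $\mathcal A$ with $\mathbf t[a\times b]=\{(\alpha^*,\beta^* )\}$. *)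

theory Defs
  imports "HOL-Algebra.Group" "HOL-Library.Disjoint_Sets"
begin

unbundle cardinal_syntax

(* A cardinal \<kappa> is a relation with Card_order \<kappa>, i.e. the (reflexive) order of an initial
   ordinal; Field \<kappa> is its set of elements, and \<alpha> < \<beta> means (\<alpha>, \<beta>) \<in> \<kappa> and \<alpha> \<noteq> \<beta>. *)

definition pairs :: "'a rel \<Rightarrow> ('a \<times> 'a) set" where
  "pairs \<kappa> = {(\<alpha>, \<beta>). (\<alpha>, \<beta>) \<in> \<kappa> \<and> \<alpha> \<noteq> \<beta>}"

definition set_less :: "'a rel \<Rightarrow> 'a set \<Rightarrow> 'a set \<Rightarrow> bool" where
  "set_less \<kappa> a b \<longleftrightarrow> (\<forall>\<alpha>\<in>a. \<forall>\<beta>\<in>b. (\<alpha>, \<beta>) \<in> pairs \<kappa>)"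

(* The points \<delta> > 0 with sup (A \<inter> \<delta>) = \<delta>. Strictness of \<alpha> < \<gamma> excludes successors, and the
   first conjunct excludes 0. *)
definition accumulation_points :: "'a rel \<Rightarrow> 'a set \<Rightarrow> 'a set" where
  "accumulation_points \<kappa> A =
     {\<delta> \<in> Field \<kappa>. underS \<kappa> \<delta> \<noteq> {} \<and>
        (\<forall>\<alpha>\<in>underS \<kappa> \<delta>. \<exists>\<gamma>\<in>A \<inter> underS \<kappa> \<delta>. (\<alpha>, \<gamma>) \<in> pairs \<kappa>)}"

definition club :: "'a rel \<Rightarrow> 'a set \<Rightarrow> bool" where
  "club \<kappa> C \<longleftrightarrow> C \<subseteq> Field \<kappa> \<and> cofinal C \<kappa> \<and> accumulation_points \<kappa> C \<subseteq> C"

definition stationary :: "'a rel \<Rightarrow> 'a set \<Rightarrow> bool" where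
  "stationary \<kappa> S \<longleftrightarrow> S \<subseteq> Field \<kappa> \<and> (\<forall>C. club \<kappa> C \<longrightarrow> S \<inter> C \<noteq> {})"

definition Pl1 :: "'a rel \<Rightarrow> bool" where
  "Pl1 \<kappa> \<longleftrightarrow>
     (\<exists>t \<in> pairs \<kappa> \<rightarrow> pairs \<kappa>.
        (\<forall>\<alpha> \<beta> \<alpha>' \<beta>'. (\<alpha>, \<beta>) \<in> pairs \<kappa> \<longrightarrow> t (\<alpha>, \<beta>) = (\<alpha>', \<beta>') \<longrightarrow>
           (\<alpha>', \<alpha>) \<in> \<kappa> \<and> (\<alpha>, \<beta>') \<in> pairs \<kappa> \<and> (\<beta>', \<beta>) \<in> \<kappa>) \<and>
        (\<forall>\<A>. (\<forall>a\<in>\<A>. finite a \<and> a \<subseteq> Field \<kappa>) \<longrightarrow> disjoint \<A> \<longrightarrow> |\<A>| =o \<kappa> \<longrightarrow>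
           (\<exists>S. stationary \<kappa> S \<and>
              (\<forall>\<alpha>'\<in>S. \<forall>\<beta>'\<in>S. (\<alpha>', \<beta>') \<in> pairs \<kappa> \<longrightarrow>
                 (\<exists>a\<in>\<A>. \<exists>b\<in>\<A>. set_less \<kappa> a b \<and> t ` (a \<times> b) = {(\<alpha>', \<beta>')})))))"

end

theory Submission
  imports Defs "HOL-Algebra.Free_Abelian_Groups" "HOL-Algebra.Weak_Morphisms"
begin

text \<open>
  From sums to pairs: identify \<open>\<kappa>\<close> with any Abelian group of size \<open>\<kappa>\<close>, colour a pair by the colour of
  its sum, and split a given set into two halves.

  From pairs to sums: composing the colouring \<open>c\<close> of pairs with the transformation \<open>t\<close> gives
  \<open>e = c \<circ> t\<close>, which takes all colours on every rectangle \<open>A \<times> B\<close> with \<open>|A| = |B| = \<kappa>\<close>: apply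
  \<open>Pl1\<close> to a family of disjoint sets \<open>{\<alpha>, f \<alpha>}\<close> with \<open>\<alpha> \<in> A\<close> and \<open>f \<alpha> \<in> B\<close>. Write \<open>G\<close> as the union
  of an increasing chain of subgroups of size less than \<open>\<kappa>\<close>, which gives a rank in \<open>\<kappa>\<close>. Subtracting
  from \<open>x\<close> a chosen representative of its coset modulo the elements of smaller rank lowers the rank,
  so iterating this operation \<open>tail\<close> yields a finite decreasing sequence of ranks, and \<open>e\<close> turns
  consecutive ranks into a finite list of colours. If all ranks of \<open>y\<close>, down to some point where
  \<open>g\<close> is left over, exceed the rank of \<open>x\<close>, then the rank sequence of \<open>x + y\<close> is that of \<open>y\<close> down to
  this point, followed by that of \<open>x + g\<close>. The only colour that depends on both \<open>x\<close> and \<open>y\<close> is the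
  one at the junction. Thinning out \<open>X\<close> and \<open>Y\<close> makes \<open>g\<close> and a natural number describing the other
  colours constant, and the final colouring is chosen such that the colour at the junction can then
  force any value.
\<close>

section \<open>Regular uncountable cardinals\<close>

locale regular_uncountable =
  fixes \<kappa> :: "'a rel"
  assumes card: "Card_order \<kappa>"
    and regular: "regularCard \<kappa>"
    and uncountable: "natLeq <o \<kappa>"
begin

lemma well_order: "Well_order \<kappa>"
  using card card_order_on_well_order_on by blast

sublocale wo: wo_rel \<kappa>
  by (simp add: wo_rel_def well_order)

lemma infinite_Field: "infinite (Field \<kappa>)"
  using uncountable card finite_iff_ordLess_natLeq card_of_Field_ordIso
  by (metis not_ordLeq_ordLess ordIso_ordLess_trans ordIso_symmetric ordLess_imp_ordLeq)

section \<open>Sets of size below \<open>\<kappa>\<close> and sets of size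
  \<open>\<kappa>\<close>\<close>

lemma small_subset: "A \<subseteq> B \<Longrightarrow> |B| <o \<kappa> \<Longrightarrow> |A| <o \<kappa>"
  using card_of_mono1 ordLeq_ordLess_trans by blast

lemma small_image: "|A| <o \<kappa> \<Longrightarrow> |f ` A| <o \<kappa>"
  using card_of_image ordLeq_ordLess_trans by blast

lemma small_countable: "countable A \<Longrightarrow> |A| <o \<kappa>"
  using uncountable ordLeq_ordLess_trans
  by (metis card_of_nat card_of_ordLeq countable_def ordLeq_ordIso_trans subset_UNIV)

lemma small_UN: "|I| <o \<kappa> \<Longrightarrow> (\<And>i. i \<in> I \<Longrightarrow> |A i| <o \<kappa>) \<Longrightarrow> |\<Union>i\<in>I. A i| <o \<kappa>"
  by (rule stable_UNION[OF regularCard_stable[OF card infinite_Field regular]])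

lemma small_Times: "|A| <o \<kappa> \<Longrightarrow> |B| <o \<kappa> \<Longrightarrow> |A \<times> B| <o \<kappa>"
  using small_UN[of A "\<lambda>a. Pair a ` B"] small_image small_subset[of "A \<times> B" "\<Union>a\<in>A. Pair a ` B"]
  by blast

lemma small_Un: "|A| <o \<kappa> \<Longrightarrow> |B| <o \<kappa> \<Longrightarrow> |A \<union> B| <o \<kappa>"
  by (rule card_of_Un_ordLess_infinite_Field[OF infinite_Field card])

lemma large_not_small: "|A| =o \<kappa> \<Longrightarrow> \<not> |A| <o \<kappa>"
  using not_ordLess_ordIso by blast

lemma large_superset: "|A| =o \<kappa> \<Longrightarrow> A \<subseteq> B \<Longrightarrow> \<not> |B| <o \<kappa>"
  using small_subset large_not_small by blast

lemma large_subset: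
  assumes "|B| =o \<kappa>" "A \<subseteq> B" "\<not> |A| <o \<kappa>"
  shows "|A| =o \<kappa>"
  using assms card_of_mono1 ordLeq_ordIso_trans ordLeq_iff_ordLess_or_ordIso by metis

lemma large_Field: "|Field \<kappa>| =o \<kappa>"
  by (rule card_of_Field_ordIso[OF card])

lemma large_Diff:
  assumes "|A| =o \<kappa>" "|B| <o \<kappa>"
  shows "|A - B| =o \<kappa>"
proof (rule large_subset[OF assms(1)])
  show "\<not> |A - B| <o \<kappa>"
  proof
    assume "|A - B| <o \<kappa>"
    from small_Un[OF this assms(2)] have "|A| <o \<kappa>"
      by (rule small_subset[rotated]) blast
    then show False
      using large_not_small assms(1) by blast
  qed
qed blast

text \<open>By regularity, fewer than \<open>\<kappa>\<close> many small fibres cannot cover a set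
  of size \<open>\<kappa>\<close>.\<close>

lemma pigeonhole:
  assumes "|Y| =o \<kappa>" "|f ` Y| <o \<kappa>"
  obtains z where "z \<in> f ` Y" "|{y\<in>Y. f y = z}| =o \<kappa>"
proof -
  have "\<exists>z\<in>f ` Y. \<not> |{y\<in>Y. f y = z}| <o \<kappa>"
  proof (rule ccontr)
    assume "\<not> ?thesis"
    then have "|\<Union>z\<in>f ` Y. {y\<in>Y. f y = z}| <o \<kappa>"
      by (intro small_UN assms) auto
    moreover have "(\<Union>z\<in>f ` Y. {y\<in>Y. f y = z}) = Y" by auto
    ultimately show False using large_not_small[OF assms(1)] by metis
  qed
  then show ?thesis
    using that large_subset[OF assms(1), of "{y\<in>Y. f y = _}"] by blast
qed

lemma large_image:
  assumes "|Y| =o \<kappa>" "\<And>z. z \<in> f ` Y \<Longrightarrow> |{y\<in>Y. f y = z}| <o \<kappa>"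
  shows "|f ` Y| =o \<kappa>"
proof -
  have "\<not> |f ` Y| <o \<kappa>"
    using pigeonhole[OF assms(1), of f] assms(2) large_not_small by metis
  moreover have "|f ` Y| \<le>o \<kappa>"
    using card_of_image ordLeq_ordIso_trans assms(1) by blast
  ultimately show ?thesis using ordLeq_iff_ordLess_or_ordIso by blast
qed

lemma large_image_inj:
  assumes "|Y| =o \<kappa>" "inj_on f Y"
  shows "|f ` Y| =o \<kappa>"
  using assms card_of_ordIsoI ordIso_symmetric ordIso_transitive inj_on_imp_bij_betw by metis

lemma large_bij:
  assumes "|A| =o \<kappa>" "|B| =o \<kappa>"
  obtains f where "bij_betw f A B"
  using assms card_of_ordIso ordIso_symmetric ordIso_transitive by metis

lemma large_halves:
  assumes "|A| =o \<kappa>"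
  obtains B C where "B \<subseteq> A" "C \<subseteq> A" "B \<inter> C = {}" "|B| =o \<kappa>" "|C| =o \<kappa>"
proof -
  have inf: "infinite A"
    using assms infinite_Field card card_of_ordIso_finite_Field ordIso_symmetric by metis
  have "|A <+> A| =o |A|"
    by (rule card_of_Plus_infinite1[OF inf ordIso_imp_ordLeq[OF card_of_refl]])
  then obtain f where f: "bij_betw f (A <+> A) A"
    using card_of_ordIso by blast
  have inj: "inj_on (f \<circ> Inl) A" "inj_on (f \<circ> Inr) A"
    using f by (auto simp: bij_betw_def inj_on_def Plus_def)
  show ?thesis
  proof (rule that)
    show "(f \<circ> Inl) ` A \<subseteq> A" "(f \<circ> Inr) ` A \<subseteq> A" "(f \<circ> Inl) ` A \<inter> (f \<circ> Inr) ` A = {}"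
      using f by (auto simp: bij_betw_def inj_on_def)
  qed (use inj large_image_inj assms in blast)+
qed

text \<open>If \<open>A \<inter> B\<close> is small, deleting it from \<open>A\<close> suffices;
  otherwise its two halves serve.\<close>

lemma large_disjoint:
  assumes "|A| =o \<kappa>" "|B| =o \<kappa>"
  obtains A' B' where "A' \<subseteq> A" "B' \<subseteq> B" "A' \<inter> B' = {}" "|A'| =o \<kappa>" "|B'| =o \<kappa>"
proof (cases "|A \<inter> B| <o \<kappa>")
  case True
  then show ?thesis
    using that[of "A - A \<inter> B" B] assms large_Diff by blast
next
  case False
  then have "|A \<inter> B| =o \<kappa>" using large_subset[OF assms(1)] by blast
  then show ?thesis using large_halves that by (metis Int_subset_iff)
qed

section \<open>The strict order \<open>pairs \<kappa>\<close> and stationary sets\<close>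

lemma pairs_trans: "(i, j) \<in> pairs \<kappa> \<Longrightarrow> (j, k) \<in> pairs \<kappa> \<Longrightarrow> (i, k) \<in> pairs \<kappa>"
  using wo.TRANS wo.ANTISYM unfolding pairs_def by (auto dest: transD antisymD)

lemma pairs_trans1: "(i, j) \<in> \<kappa> \<Longrightarrow> (j, k) \<in> pairs \<kappa> \<Longrightarrow> (i, k) \<in> pairs \<kappa>"
  using wo.TRANS wo.ANTISYM unfolding pairs_def by (auto dest: transD antisymD)

lemma pairs_trans2: "(i, j) \<in> pairs \<kappa> \<Longrightarrow> (j, k) \<in> \<kappa> \<Longrightarrow> (i, k) \<in> pairs \<kappa>"
  using wo.TRANS wo.ANTISYM unfolding pairs_def by (auto dest: transD antisymD)

lemma pairs_irrefl: "(i, i) \<notin> pairs \<kappa>"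
  by (simp add: pairs_def)

lemma pairs_Field: "(i, j) \<in> pairs \<kappa> \<Longrightarrow> i \<in> Field \<kappa> \<and> j \<in> Field \<kappa>"
  unfolding pairs_def Field_def by auto

lemma pairs_linear: "i \<in> Field \<kappa> \<Longrightarrow> j \<in> Field \<kappa> \<Longrightarrow> i = j \<or> (i, j) \<in> pairs \<kappa> \<or> (j, i) \<in> pairs \<kappa>"
  using wo.TOTALS unfolding pairs_def by auto

lemma pairs_above: "i \<in> Field \<kappa> \<Longrightarrow> \<exists>j. (i, j) \<in> pairs \<kappa>"
  using infinite_Card_order_limit[OF card infinite_Field] unfolding pairs_def by blast

lemma wf_pairs: "wf (pairs \<kappa>)"
proof -
  have "pairs \<kappa> = \<kappa> - Id" by (auto simp: pairs_def)
  then show ?thesis using wo.WF by simp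
qed

text \<open>Final segments are club, so \<open>S\<close> meets all of them and is cofinal; by
  regularity a cofinal set has size \<open>\<kappa>\<close>.\<close>

lemma stationary_large:
  assumes "stationary \<kappa> S"
  shows "|S| =o \<kappa>"
proof -
  have "cofinal S \<kappa>"
    unfolding cofinal_def
  proof
    fix i assume i: "i \<in> Field \<kappa>"
    let ?C = "{j. (i, j) \<in> pairs \<kappa>}"
    have "club \<kappa> ?C"
      unfolding club_def
    proof (intro conjI)
      show "?C \<subseteq> Field \<kappa>" using pairs_Field by blast
      show "cofinal ?C \<kappa>"
        unfolding cofinal_def
      proof
        fix j assume j: "j \<in> Field \<kappa>"
        obtain k where k: "k \<in> Field \<kappa>" "(i, k) \<in> \<kappa>" "(j, k) \<in> \<kappa>"
          using i j wo.TOTALS wo.REFL by (metis refl_on_def)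
        then obtain l where "(k, l) \<in> pairs \<kappa>" using pairs_above by blast
        then show "\<exists>l\<in>?C. j \<noteq> l \<and> (j, l) \<in> \<kappa>"
          using pairs_trans1 k unfolding pairs_def by blast
      qed
      show "accumulation_points \<kappa> ?C \<subseteq> ?C"
      proof
        fix d assume d: "d \<in> accumulation_points \<kappa> ?C"
        then obtain g where "g \<in> ?C" "g \<in> underS \<kappa> d"
          unfolding accumulation_points_def by blast
        then have "(i, g) \<in> pairs \<kappa>" "(g, d) \<in> pairs \<kappa>"
          by (auto simp: underS_def pairs_def)
        then show "d \<in> ?C" using pairs_trans by blast
      qed
    qed
    then obtain j where "j \<in> S" "(i, j) \<in> pairs \<kappa>"
      using assms unfolding stationary_def by blast
    then show "\<exists>j\<in>S. i \<noteq> j \<and> (i, j) \<in> \<kappa>"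
      unfolding pairs_def by blast
  qed
  then show ?thesis
    using regular assms unfolding regularCard_def stationary_def by blast
qed

section \<open>From squares to rectangles\<close>

lemma rectangular_colouring:
  assumes Pl1: "Pl1 \<kappa>"
    and c: "c \<in> pairs \<kappa> \<rightarrow> T"
    and square: "\<And>X \<tau>. X \<subseteq> Field \<kappa> \<Longrightarrow> |X| =o \<kappa> \<Longrightarrow> \<tau> \<in> T \<Longrightarrow>
        \<exists>x\<in>X. \<exists>y\<in>X. (x, y) \<in> pairs \<kappa> \<and> c (x, y) = \<tau>"
  obtains e where "e \<in> pairs \<kappa> \<rightarrow> T"
    and "\<And>A B \<tau>. A \<subseteq> Field \<kappa> \<Longrightarrow> B \<subseteq> Field \<kappa> \<Longrightarrow> |A| =o \<kappa> \<Longrightarrow> |B| =o \<kappa> \<Longrightarrow> \<tau> \<in> T \<Longrightarrow>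
        \<exists>\<alpha>\<in>A. \<exists>\<beta>\<in>B. (\<alpha>, \<beta>) \<in> pairs \<kappa> \<and> e (\<alpha>, \<beta>) = \<tau>"
proof -
  from Pl1 obtain t where t: "t \<in> pairs \<kappa> \<rightarrow> pairs \<kappa>"
    and t_hits: "\<And>\<A>. (\<forall>a\<in>\<A>. finite a \<and> a \<subseteq> Field \<kappa>) \<Longrightarrow> disjoint \<A> \<Longrightarrow> |\<A>| =o \<kappa> \<Longrightarrow>
           (\<exists>S. stationary \<kappa> S \<and>
              (\<forall>\<alpha>'\<in>S. \<forall>\<beta>'\<in>S. (\<alpha>', \<beta>') \<in> pairs \<kappa> \<longrightarrow>
                 (\<exists>a\<in>\<A>. \<exists>b\<in>\<A>. set_less \<kappa> a b \<and> t ` (a \<times> b) = {(\<alpha>', \<beta>')})))"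
    unfolding Pl1_def by blast
  show ?thesis
  proof (rule that[of "c \<circ> t"])
    show "c \<circ> t \<in> pairs \<kappa> \<rightarrow> T" using c t by auto
  next
    fix A B \<tau>
    assume AB: "A \<subseteq> Field \<kappa>" "B \<subseteq> Field \<kappa>" "|A| =o \<kappa>" "|B| =o \<kappa>" and \<tau>: "\<tau> \<in> T"
    \<comment> \<open>Disjointness of \<open>A'\<close> and \<open>B'\<close> keeps
      \<open>f \<beta>\<close> different from \<open>\<alpha>\<close>, so that distinct sets
      \<open>?p \<alpha>\<close> are disjoint.\<close>
    obtain A' B' where sub: "A' \<subseteq> A" "B' \<subseteq> B" "A' \<inter> B' = {}" and large: "|A'| =o \<kappa>" "|B'| =o \<kappa>"
      using large_disjoint AB by metis
    obtain f where f: "bij_betw f A' B'" using large_bij large by metis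
    let ?p = "\<lambda>\<alpha>. {\<alpha>, f \<alpha>}"
    have fB: "f \<alpha> \<in> B'" if "\<alpha> \<in> A'" for \<alpha>
      using f that bij_betwE by blast
    have disj: "?p \<alpha> \<inter> ?p \<beta> = {}" if "\<alpha> \<in> A'" "\<beta> \<in> A'" "\<alpha> \<noteq> \<beta>" for \<alpha> \<beta>
      using that f fB sub(3) by (auto simp: bij_betw_def inj_on_def)
    have inj: "inj_on ?p A'"
      by (rule inj_onI) (use disj in blast)
    have disjoint: "disjoint (?p ` A')"
    proof (rule disjointI)
      fix a b assume "a \<in> ?p ` A'" "b \<in> ?p ` A'" "a \<noteq> b"
      then obtain \<alpha> \<beta> where "\<alpha> \<in> A'" "a = ?p \<alpha>" "\<beta> \<in> A'" "b = ?p \<beta>" "\<alpha> \<noteq> \<beta>" by auto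
      then show "a \<inter> b = {}" using disj by simp
    qed
    have "\<forall>a\<in>?p ` A'. finite a \<and> a \<subseteq> Field \<kappa>"
      using fB sub AB by blast
    from t_hits[OF this disjoint large_image_inj[OF large(1) inj]]
    obtain S where S: "stationary \<kappa> S"
      and hit: "\<And>\<alpha>' \<beta>'. \<alpha>' \<in> S \<Longrightarrow> \<beta>' \<in> S \<Longrightarrow> (\<alpha>', \<beta>') \<in> pairs \<kappa> \<Longrightarrow>
        \<exists>a\<in>?p ` A'. \<exists>b\<in>?p ` A'. set_less \<kappa> a b \<and> t ` (a \<times> b) = {(\<alpha>', \<beta>')}"
      by blast
    have "S \<subseteq> Field \<kappa>" using S by (simp add: stationary_def)
    from square[OF this stationary_large[OF S] \<tau>]
    obtain \<alpha>' \<beta>' where ab: "\<alpha>' \<in> S" "\<beta>' \<in> S" "(\<alpha>', \<beta>') \<in> pairs \<kappa>" "c (\<alpha>', \<beta>') = \<tau>" by blast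
    from hit[OF this(1-3)] obtain \<alpha> \<beta> where
      \<alpha>\<beta>: "\<alpha> \<in> A'" "\<beta> \<in> A'" "set_less \<kappa> (?p \<alpha>) (?p \<beta>)" "t ` (?p \<alpha> \<times> ?p \<beta>) = {(\<alpha>', \<beta>')}"
      by blast
    \<comment> \<open>\<open>t\<close> is constant on
      \<open>?p \<alpha> \<times> ?p \<beta>\<close>; the corner
      \<open>(\<alpha>, f \<beta>)\<close> is the one that lies in
      \<open>A \<times> B\<close>.\<close>
    then have "(\<alpha>, f \<beta>) \<in> pairs \<kappa>" "t (\<alpha>, f \<beta>) = (\<alpha>', \<beta>')"
      unfolding set_less_def by auto
    then show "\<exists>\<alpha>\<in>A. \<exists>\<beta>\<in>B. (\<alpha>, \<beta>) \<in> pairs \<kappa> \<and> (c \<circ> t) (\<alpha>, \<beta>) = \<tau>"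
      using \<alpha>\<beta>(1,2) fB sub ab(4) by (metis comp_apply subsetD)
  qed
qed

end

section \<open>Combining lists of colours\<close>

text \<open>In the finite case add colours modulo the number of colours; in the infinite case identify
  \<open>T\<close> with \<open>nat \<times> T\<close> and let the entry with the largest first coordinate win.\<close>

lemma dominating_colour:
  fixes T :: "'b set"
  assumes "T \<noteq> {}"
  obtains \<Psi> :: "'b list \<Rightarrow> 'b" and q :: "'b list \<Rightarrow> nat"
  where "\<And>us. set us \<subseteq> T \<Longrightarrow> \<Psi> us \<in> T"
    and "\<And>m n \<tau>. \<tau> \<in> T \<Longrightarrow> \<exists>\<sigma>\<in>T. \<forall>us vs. set us \<subseteq> T \<longrightarrow> set vs \<subseteq> T \<longrightarrow> q us = m \<longrightarrow> q vs = n \<longrightarrow>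
           \<Psi> (us @ \<sigma> # vs) = \<tau>"
proof (cases "finite T")
  case True
  define N where "N = card T"
  have N: "N > 0" using True assms by (simp add: N_def card_gt_0_iff)
  obtain h where h: "bij_betw h T {..<N}"
    using True ex_bij_betw_finite_nat[of T] by (auto simp: N_def atLeast0LessThan)
  let ?q = "\<lambda>us. sum_list (map h us)"
  let ?\<Psi> = "\<lambda>us. inv_into T h (?q us mod N)"
  show ?thesis
  proof (rule that[of ?\<Psi> ?q])
    show "?\<Psi> us \<in> T" for us
      using h N by (intro inv_into_into) (simp add: bij_betw_def)
    fix m n \<tau> assume \<tau>: "\<tau> \<in> T"
    \<comment> \<open>Modulo \<open>N\<close>, \<open>(m + n) * (N - 1)\<close> is
      \<open>-(m + n)\<close>, so \<open>s\<close> solves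
      \<open>m + s + n = h \<tau>\<close>.\<close>
    define s where "s = (h \<tau> + (m + n) * (N - 1)) mod N"
    define \<sigma> where "\<sigma> = inv_into T h s"
    have s: "s \<in> h ` T" using h N by (simp add: bij_betw_def s_def)
    have \<sigma>: "\<sigma> \<in> T" "h \<sigma> = s"
      using s unfolding \<sigma>_def by (auto simp: inv_into_into f_inv_into_f)
    have "(m + (s + n)) mod N = (m + n + (h \<tau> + (m + n) * (N - 1))) mod N"
      unfolding s_def by (metis add.assoc add.commute mod_add_right_eq)
    also have "m + n + (h \<tau> + (m + n) * (N - 1)) = h \<tau> + (m + n) * N"
      using N by (cases N) auto
    finally have "(m + (s + n)) mod N = h \<tau>"
      using h \<tau> by (metis bij_betwE lessThan_iff mod_less mod_mult_self1)
    then have "\<forall>us vs. ?q us = m \<longrightarrow> ?q vs = n \<longrightarrow> ?\<Psi> (us @ \<sigma> # vs) = \<tau>"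
      using h \<tau> \<sigma> by (auto simp: bij_betw_def)
    then show "\<exists>\<sigma>\<in>T. \<forall>us vs. set us \<subseteq> T \<longrightarrow> set vs \<subseteq> T \<longrightarrow> ?q us = m \<longrightarrow> ?q vs = n \<longrightarrow>
           ?\<Psi> (us @ \<sigma> # vs) = \<tau>" using \<sigma>(1) by blast
  qed
next
  case False
  have "|UNIV :: nat set| \<le>o |T|"
    using False infinite_iff_card_of_nat by blast
  then have "|(UNIV :: nat set) \<times> T| =o |T|"
    using card_of_Times_infinite[of T "UNIV :: nat set"] False by auto
  then obtain g where g: "bij_betw g T ((UNIV :: nat set) \<times> T)"
    using card_of_ordIso ordIso_symmetric by metis
  obtain t where t: "t \<in> T" using assms by blast
  \<comment> \<open>As a sum of natural numbers, \<open>?q us\<close> bounds every first coordinate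
    occurring in \<open>us\<close>.\<close>
  let ?q = "\<lambda>us. sum_list (map (fst \<circ> g) us)"
  let ?w = "\<lambda>us s. s \<in> set us \<and> (\<forall>s'\<in>set us. fst (g s') \<le> fst (g s))"
  let ?\<Psi> = "\<lambda>us. if us = [] then t else snd (g (SOME s. ?w us s))"
  show ?thesis
  proof (rule that[of ?\<Psi> ?q])
    fix us assume us: "set us \<subseteq> T"
    have "\<exists>s. ?w us s" if "us \<noteq> []"
    proof -
      have "Max (fst ` g ` set us) \<in> fst ` g ` set us"
        using that by (intro Max_in) auto
      then obtain s where "s \<in> set us" "Max (fst ` g ` set us) = fst (g s)" by blast
      then show ?thesis by (metis List.finite_set Max_ge finite_imageI imageI)
    qed
    then have "(SOME s. ?w us s) \<in> T" if "us \<noteq> []"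
      using us that someI_ex[of "?w us"] by blast
    then have "g (SOME s. ?w us s) \<in> UNIV \<times> T" if "us \<noteq> []"
      using g that bij_betwE by blast
    then show "?\<Psi> us \<in> T" using t by (auto simp: mem_Times_iff)
  next
    fix m n \<tau> assume \<tau>: "\<tau> \<in> T"
    \<comment> \<open>First coordinates in \<open>us\<close> and \<open>vs\<close> are at most
      \<open>m\<close> and \<open>n\<close>, so \<open>m + n + 1\<close> makes
      \<open>\<sigma>\<close> the unique winner.\<close>
    then obtain \<sigma> where \<sigma>: "\<sigma> \<in> T" "g \<sigma> = (m + n + 1, \<tau>)"
      using g by (metis UNIV_I bij_betw_def imageE mem_Sigma_iff)
    have "?\<Psi> (us @ \<sigma> # vs) = \<tau>" if "?q us = m" "?q vs = n" for us vs
    proof -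
      have *: "fst (g s) < fst (g \<sigma>)" if "s \<in> set us \<union> set vs" for s
      proof -
        have "fst (g s) \<le> ?q us \<or> fst (g s) \<le> ?q vs"
          using that member_le_sum_list[of "fst (g s)" "map (fst \<circ> g) us"]
            member_le_sum_list[of "fst (g s)" "map (fst \<circ> g) vs"] by auto
        then show ?thesis using \<sigma> \<open>?q us = m\<close> \<open>?q vs = n\<close> by auto
      qed
      have "(SOME s. ?w (us @ \<sigma> # vs) s) = \<sigma>"
      proof (rule some_equality)
        show "?w (us @ \<sigma> # vs) \<sigma>" using * by (auto intro: less_imp_le)
        show "s = \<sigma>" if "?w (us @ \<sigma> # vs) s" for s
          using that *[of s] by (auto simp: not_le[symmetric])
      qed
      then show ?thesis using \<sigma> by simp
    qed
    then show "\<exists>\<sigma>\<in>T. \<forall>us vs. set us \<subseteq> T \<longrightarrow> set vs \<subseteq> T \<longrightarrow> ?q us = m \<longrightarrow> ?q vs = n \<longrightarrow>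
           ?\<Psi> (us @ \<sigma> # vs) = \<tau>" using \<sigma>(1) by blast
  qed
qed

section \<open>Ranks on groups\<close>

context regular_uncountable
begin

text \<open>Countably many stages, each adding the products of two elements of the previous one,
  exhaust the subgroup. All stages are small, hence so is their union.\<close>

lemma small_generate:
  fixes G (structure)
  assumes "group G" and A: "|A| <o \<kappa>"
  shows "|generate G A| <o \<kappa>"
proof -
  \<comment> \<open>Stage 0 already contains the inverses of the generators, so that only products
    have to be added later.\<close>
  define S where "S = rec_nat ({\<one>} \<union> A \<union> m_inv G ` A)
    (\<lambda>_ B. B \<union> (\<lambda>(x, y). x \<otimes> y) ` (B \<times> B))"
  have S_0: "S 0 = {\<one>} \<union> A \<union> m_inv G ` A"
    and S_Suc: "S (Suc n) = S n \<union> (\<lambda>(x, y). x \<otimes> y) ` (S n \<times> S n)" for n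
    by (simp_all add: S_def)
  have mono: "S m \<subseteq> S n" if "m \<le> n" for m n
    by (rule lift_Suc_mono_le[OF _ that]) (simp add: S_Suc)
  have small: "|S n| <o \<kappa>" for n
  proof (induction n)
    case 0
    show ?case unfolding S_0
      by (intro small_Un small_image A small_countable) auto
  next
    case (Suc n)
    then show ?case unfolding S_Suc
      by (intro small_Un small_image small_Times)
  qed
  have "generate G A \<subseteq> (\<Union>n. S n)"
  proof
    fix x assume "x \<in> generate G A"
    then show "x \<in> (\<Union>n. S n)"
    proof induction
      case (eng x y)
      then obtain m n where mn: "x \<in> S m" "y \<in> S n" by auto
      then have "x \<in> S (max m n)" "y \<in> S (max m n)"
        using mono[of m "max m n"] mono[of n "max m n"] by auto
      then have "x \<otimes> y \<in> S (Suc (max m n))" unfolding S_Suc by auto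
      then show ?case by blast
    qed (use S_0 in blast)+
  qed
  then show ?thesis
    using small_subset small_UN[of "UNIV :: nat set" S] small small_countable[of "UNIV :: nat set"]
    by blast
qed

text \<open>The rank of \<open>x\<close> is the first index at which \<open>x\<close> enters a chain
  of small subgroups. The strict bounds express that the elements of rank below \<open>i\<close> are
  closed under products and inverses.\<close>

lemma rank_exists:
  fixes G (structure)
  assumes "group G" and "|carrier G| =o \<kappa>"
  obtains r where "r \<in> carrier G \<rightarrow> Field \<kappa>"
    and "\<And>x y i. x \<in> carrier G \<Longrightarrow> y \<in> carrier G \<Longrightarrow> (r x, i) \<in> pairs \<kappa> \<Longrightarrow> (r y, i) \<in> pairs \<kappa>
           \<Longrightarrow> (r (x \<otimes> y), i) \<in> pairs \<kappa>"
    and "\<And>x i. x \<in> carrier G \<Longrightarrow> (r x, i) \<in> pairs \<kappa> \<Longrightarrow> (r (inv x), i) \<in> pairs \<kappa>"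
    and "\<And>i. |{x \<in> carrier G. r x = i}| <o \<kappa>"
proof -
  interpret group G by fact
  obtain f where f: "bij_betw f (carrier G) (Field \<kappa>)"
    using large_bij assms(2) large_Field by metis
  \<comment> \<open>The bound is not strict, so \<open>x\<close> itself lies in
    \<open>g (f x)\<close> and every element receives a rank.\<close>
  define g where "g i = {x \<in> carrier G. (f x, i) \<in> \<kappa>}" for i
  define H where "H i = generate G (g i)" for i
  define r where "r x = wo.minim {i \<in> Field \<kappa>. x \<in> H i}" for x
  have g_carrier: "g i \<subseteq> carrier G" for i by (auto simp: g_def)
  have H: "subgroup (H i) G" for i
    unfolding H_def using generate_is_subgroup g_carrier by blast
  have H_mono: "H i \<subseteq> H j" if "(i, j) \<in> \<kappa>" for i j
    unfolding H_def using that wo.TRANS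
    by (intro mono_generate) (auto simp: g_def dest: transD)
  have r: "r x \<in> Field \<kappa> \<and> x \<in> H (r x)" if x: "x \<in> carrier G" for x
  proof -
    have fx: "f x \<in> Field \<kappa>" using f x bij_betwE by blast
    then have "x \<in> g (f x)" using x wo.REFL by (auto simp: g_def refl_on_def)
    then have "f x \<in> {i \<in> Field \<kappa>. x \<in> H i}" using fx generate.incl by (simp add: H_def)
    then have "r x \<in> {i \<in> Field \<kappa>. x \<in> H i}"
      unfolding r_def by (intro wo.minim_in) auto
    then show ?thesis by simp
  qed
  have r_least: "(r x, i) \<in> \<kappa>" if "i \<in> Field \<kappa>" "x \<in> H i" for x i
    unfolding r_def using that by (intro wo.minim_least) auto
  have g_small: "|g i| <o \<kappa>" if "i \<in> Field \<kappa>" for i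
  proof -
    have "f ` g i \<subseteq> underS \<kappa> i \<union> {i}" by (auto simp: g_def underS_def)
    moreover have "|underS \<kappa> i \<union> {i}| <o \<kappa>"
      by (intro small_Un card_of_underS[OF card that] small_countable) simp
    ultimately have "|f ` g i| <o \<kappa>" by (rule small_subset)
    moreover have "g i = inv_into (carrier G) f ` f ` g i"
      using f g_carrier by (simp add: bij_betw_def)
    ultimately show ?thesis using small_image by metis
  qed
  show ?thesis
  proof (rule that[of r])
    show "r \<in> carrier G \<rightarrow> Field \<kappa>" using r by blast
  next
    fix x y i
    assume x: "x \<in> carrier G" and y: "y \<in> carrier G"
      and *: "(r x, i) \<in> pairs \<kappa>" "(r y, i) \<in> pairs \<kappa>"
    \<comment> \<open>\<open>m\<close> is the larger of the two ranks: \<open>H m\<close> contains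
      both elements, and \<open>m\<close> is still below \<open>i\<close>.\<close>
    have "\<exists>m \<in> {r x, r y}. (r x, m) \<in> \<kappa> \<and> (r y, m) \<in> \<kappa>"
      using r[OF x] r[OF y] wo.TOTALS by blast
    then obtain m where m: "m \<in> {r x, r y}" "(r x, m) \<in> \<kappa>" "(r y, m) \<in> \<kappa>" by blast
    then have "x \<in> H m" "y \<in> H m" using H_mono r x y by blast+
    then have "x \<otimes> y \<in> H m" using H by (simp add: subgroup.m_closed)
    then have "(r (x \<otimes> y), m) \<in> \<kappa>" using r_least m r x y by blast
    then show "(r (x \<otimes> y), i) \<in> pairs \<kappa>" using m(1) * pairs_trans1 by blast
  next
    fix x i assume x: "x \<in> carrier G" and *: "(r x, i) \<in> pairs \<kappa>"
    have "inv x \<in> H (r x)" using r[OF x] H by (simp add: subgroup.m_inv_closed)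
    then show "(r (inv x), i) \<in> pairs \<kappa>" using r_least r[OF x] * pairs_trans1 by blast
  next
    fix i
    show "|{x \<in> carrier G. r x = i}| <o \<kappa>"
    proof (cases "i \<in> Field \<kappa>")
      case True
      have "|H i| <o \<kappa>" unfolding H_def by (rule small_generate[OF assms(1) g_small[OF True]])
      then show ?thesis by (rule small_subset[rotated]) (use r in auto)
    next
      case False
      then have "{x \<in> carrier G. r x = i} = {}" using r by blast
      then show ?thesis using small_countable[OF countable_empty] by metis
    qed
  qed
qed

end

section \<open>Groups with an ultrametric rank\<close>

locale ranked_group = regular_uncountable \<kappa> + comm_group G
  for \<kappa> :: "'a rel" and G :: "('g, 'm) monoid_scheme" (structure) +
  fixes r :: "'g \<Rightarrow> 'a"
  assumes rank_closed: "x \<in> carrier G \<Longrightarrow> r x \<in> Field \<kappa>"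
    and rank_mult: "x \<in> carrier G \<Longrightarrow> y \<in> carrier G \<Longrightarrow> (r x, i) \<in> pairs \<kappa> \<Longrightarrow> (r y, i) \<in> pairs \<kappa>
           \<Longrightarrow> (r (x \<otimes> y), i) \<in> pairs \<kappa>"
    and rank_inv: "x \<in> carrier G \<Longrightarrow> (r x, i) \<in> pairs \<kappa> \<Longrightarrow> (r (inv x), i) \<in> pairs \<kappa>"
    and rank_fibre: "|{x \<in> carrier G. r x = i}| <o \<kappa>"
begin

text \<open>Otherwise \<open>\<one> = x \<otimes> inv x\<close> would have rank below
  \<open>r \<one>\<close>.\<close>

lemma rank_one:
  assumes "x \<in> carrier G"
  shows "(r x, r \<one>) \<notin> pairs \<kappa>"
proof
  assume "(r x, r \<one>) \<in> pairs \<kappa>"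
  then have "(r (x \<otimes> inv x), r \<one>) \<in> pairs \<kappa>"
    by (intro rank_mult[OF assms inv_closed[OF assms]] rank_inv[OF assms])
  then show False using assms pairs_irrefl by simp
qed

lemma rank_one_less: "x \<in> carrier G \<Longrightarrow> r x \<noteq> r \<one> \<Longrightarrow> (r \<one>, r x) \<in> pairs \<kappa>"
  using rank_one[of x] pairs_linear[of "r x" "r \<one>"] rank_closed by auto

text \<open>As for an ultrametric: a smaller rank of \<open>x \<otimes> y\<close> would put
  \<open>y = inv x \<otimes> (x \<otimes> y)\<close> below its own rank, and a larger one
  contradicts \<open>rank_mult\<close>.\<close>

lemma rank_dominant:
  assumes "x \<in> carrier G" "y \<in> carrier G" "(r x, r y) \<in> pairs \<kappa>"
  shows "r (x \<otimes> y) = r y"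
proof -
  have "inv x \<otimes> (x \<otimes> y) = y"
    using assms by (simp add: m_assoc[symmetric])
  then have "(r (x \<otimes> y), r y) \<notin> pairs \<kappa>"
    using rank_mult[of "inv x" "x \<otimes> y" "r y"] rank_inv[of x "r y"] assms pairs_irrefl by auto
  moreover have "(r y, r (x \<otimes> y)) \<notin> pairs \<kappa>"
    using rank_mult[of x y] assms pairs_trans pairs_irrefl by blast
  ultimately show ?thesis
    using pairs_linear[of "r (x \<otimes> y)" "r y"] rank_closed assms by auto
qed

section \<open>Cosets and tails\<close>

text \<open>For \<open>x\<close> in the group with \<open>r x \<noteq> r \<one>\<close> this is the
  coset of \<open>x\<close> modulo the elements of rank below \<open>r x\<close>; if
  \<open>r x = r \<one>\<close>, it is empty by \<open>rank_one\<close>.\<close>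

definition coset :: "'g \<Rightarrow> 'g set" where
  "coset x = {z \<in> carrier G. (r (z \<otimes> inv x), r x) \<in> pairs \<kappa>}"

text \<open>The representative is chosen from the set \<open>coset x\<close> alone, so elements with
  the same coset share it; \<open>tail_mult\<close> relies on this.\<close>

definition tail :: "'g \<Rightarrow> 'g" where
  "tail x = x \<otimes> inv (SOME z. z \<in> coset x)"

lemma some_coset:
  assumes "x \<in> carrier G" "r x \<noteq> r \<one>"
  shows "(SOME z. z \<in> coset x) \<in> coset x"
proof -
  have "x \<in> coset x" using assms rank_one_less by (simp add: coset_def)
  then show ?thesis by (rule someI)
qed

lemma tail_closed:
  assumes "x \<in> carrier G" "r x \<noteq> r \<one>"
  shows "tail x \<in> carrier G"
proof -
  have "coset x \<subseteq> carrier G" by (auto simp: coset_def)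
  then have "(SOME z. z \<in> coset x) \<in> carrier G" using some_coset[OF assms] by blast
  then show ?thesis using assms(1) by (simp add: tail_def)
qed

lemma rank_tail:
  assumes "x \<in> carrier G" "r x \<noteq> r \<one>"
  shows "(r (tail x), r x) \<in> pairs \<kappa>"
proof -
  define z where "z = (SOME z. z \<in> coset x)"
  have z: "z \<in> carrier G" "(r (z \<otimes> inv x), r x) \<in> pairs \<kappa>"
    using some_coset[OF assms] by (auto simp: z_def coset_def)
  have "tail x = inv (z \<otimes> inv x)"
    using z assms by (simp add: tail_def z_def[symmetric] inv_mult m_comm)
  then show ?thesis using rank_inv z assms by simp
qed

text \<open>By \<open>rank_dominant\<close> both cosets are taken modulo the same elements, and
  \<open>x\<close> is one of these.\<close>

lemma coset_mult:
  assumes "x \<in> carrier G" "y \<in> carrier G" "(r x, r y) \<in> pairs \<kappa>"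
  shows "coset (x \<otimes> y) = coset y"
proof -
  have "(r (z \<otimes> inv (x \<otimes> y)), r y) \<in> pairs \<kappa> \<longleftrightarrow> (r (z \<otimes> inv y), r y) \<in> pairs \<kappa>"
    if z: "z \<in> carrier G" for z
  proof
    have *: "z \<otimes> inv (x \<otimes> y) = inv x \<otimes> (z \<otimes> inv y)"
      using assms z by (simp add: inv_mult m_ac)
    then have **: "z \<otimes> inv y = x \<otimes> (z \<otimes> inv (x \<otimes> y))"
      using assms z by (simp add: m_assoc[symmetric])
    show "(r (z \<otimes> inv y), r y) \<in> pairs \<kappa>" if "(r (z \<otimes> inv (x \<otimes> y)), r y) \<in> pairs \<kappa>"
      unfolding ** by (rule rank_mult) (use assms z that in auto)
    show "(r (z \<otimes> inv (x \<otimes> y)), r y) \<in> pairs \<kappa>" if "(r (z \<otimes> inv y), r y) \<in> pairs \<kappa>"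
      unfolding * by (rule rank_mult) (use assms z that rank_inv in auto)
  qed
  then show ?thesis using rank_dominant[OF assms] by (auto simp: coset_def)
qed

text \<open>The same representative is removed from \<open>x \<otimes> y\<close> and from
  \<open>y\<close>, so the factor \<open>x\<close> survives.\<close>

lemma tail_mult:
  assumes "x \<in> carrier G" "y \<in> carrier G" "(r x, r y) \<in> pairs \<kappa>"
  shows "tail (x \<otimes> y) = x \<otimes> tail y"
proof -
  have "r y \<noteq> r \<one>" using assms rank_one[of x] by auto
  then have "(SOME z. z \<in> coset y) \<in> carrier G"
    using some_coset assms(2) by (simp add: coset_def)
  then show ?thesis
    using assms by (simp add: tail_def coset_mult m_assoc)
qed

section \<open>Lists of colours along decreasing ranks\<close>

context
  fixes e :: "'a \<times> 'a \<Rightarrow> 'c"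
begin

text \<open>The least rank \<open>r \<one>\<close> ends the list; it is reached because
  \<open>rank_tail\<close> lowers the rank at each step.\<close>

function colours :: "'g \<Rightarrow> 'c list" where
  "colours x = (if x \<in> carrier G \<and> r x \<noteq> r \<one> then e (r (tail x), r x) # colours (tail x) else [])"
  by auto
termination
  by (relation "inv_image (pairs \<kappa>) r") (auto simp: wf_pairs rank_tail)

declare colours.simps [simp del]

lemma colours_closed:
  assumes "e \<in> pairs \<kappa> \<rightarrow> T"
  shows "set (colours x) \<subseteq> T"
proof (induction x rule: colours.induct)
  case (1 x)
  then show ?case
    using assms rank_tail[of x] colours.simps[of x] by auto
qed

text \<open>For an element of the group, these are the first \<open>n\<close> entries of
  \<open>colours e x\<close>, provided that the least rank is not reached before.\<close>

fun head_colours :: "nat \<Rightarrow> 'g \<Rightarrow> 'c list" where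
  "head_colours 0 x = []"
| "head_colours (Suc n) x = e (r (tail x), r x) # head_colours n (tail x)"

lemma head_colours_closed:
  assumes "e \<in> pairs \<kappa> \<rightarrow> T" "x \<in> carrier G"
    and "\<And>i. i < n \<Longrightarrow> r ((tail ^^ i) x) \<noteq> r \<one>"
  shows "set (head_colours n x) \<subseteq> T"
  using assms(2,3)
proof (induction n arbitrary: x)
  case (Suc n)
  have "r x \<noteq> r \<one>" using Suc.prems(2)[of 0] by simp
  moreover from this have "set (head_colours n (tail x)) \<subseteq> T"
    using Suc.prems(2)[of "Suc _"] Suc.prems(1)
    by (intro Suc.IH tail_closed) (auto simp: funpow_swap1)
  ultimately show ?case using assms(1) rank_tail Suc.prems(1) by auto
qed simp

text \<open>While the ranks of the tails of \<open>y\<close> exceed \<open>r x\<close>,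
  \<open>tail\<close> commutes with multiplication by \<open>x\<close> and the ranks stay those of
  \<open>y\<close>. The entry at index \<open>n\<close> is the first whose lower rank may feel
  \<open>x\<close>.\<close>

lemma colours_mult:
  assumes "x \<in> carrier G" "y \<in> carrier G"
    and "\<And>i. i \<le> n \<Longrightarrow> (r x, r ((tail ^^ i) y)) \<in> pairs \<kappa>"
  shows "colours (x \<otimes> y) = head_colours n y @
    e (r (x \<otimes> (tail ^^ Suc n) y), r ((tail ^^ n) y)) # colours (x \<otimes> (tail ^^ Suc n) y)"
  using assms(2,3)
proof (induction n arbitrary: y)
  case 0
  then have "(r x, r y) \<in> pairs \<kappa>" by simp
  then show ?case
    using assms(1) 0(1) rank_one[of x] colours.simps[of "x \<otimes> y"]
    by (auto simp: rank_dominant tail_mult)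
next
  case (Suc n)
  have xy: "(r x, r y) \<in> pairs \<kappa>" using Suc.prems(2)[of 0] by simp
  then have "r y \<noteq> r \<one>" using assms(1) rank_one[of x] by auto
  then have tail: "tail y \<in> carrier G" using Suc.prems tail_closed by blast
  have "(r x, r ((tail ^^ i) (tail y))) \<in> pairs \<kappa>" if "i \<le> n" for i
    using Suc.prems(2)[of "Suc i"] that by (simp add: funpow_swap1)
  from Suc.IH[OF tail this] have IH: "colours (x \<otimes> tail y) = head_colours n (tail y) @
    e (r (x \<otimes> (tail ^^ Suc n) (tail y)), r ((tail ^^ n) (tail y))) # colours (x \<otimes> (tail ^^ Suc n) (tail y))"
    by blast
  have "x \<otimes> y \<in> carrier G" "r (x \<otimes> y) = r y" "r y \<noteq> r \<one>" "tail (x \<otimes> y) = x \<otimes> tail y"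
    using assms(1) Suc.prems(1) xy \<open>r y \<noteq> r \<one>\<close> by (simp_all add: rank_dominant tail_mult)
  moreover have "(tail ^^ Suc n) (tail y) = (tail ^^ Suc (Suc n)) y" "(tail ^^ n) (tail y) = (tail ^^ Suc n) y"
    by (simp_all add: funpow_swap1)
  \<comment> \<open>Index 1 is within the bound \<open>Suc n\<close>, so the first entry is still
    that of \<open>y\<close>.\<close>
  moreover have "r (x \<otimes> tail y) = r (tail y)"
    using Suc.prems(2)[of 1] assms(1) tail by (simp add: rank_dominant)
  ultimately show ?case
    using IH colours.simps[of "x \<otimes> y"] by (simp del: funpow.simps)
qed

end

section \<open>Iterated tails\<close>

text \<open>The first \<open>k\<close> applications of \<open>tail\<close> all start above the least
  rank, so each stays in the group and lowers the rank; the \<open>k\<close>-th iterate itself may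
  have rank \<open>r \<one>\<close>.\<close>

definition long :: "nat \<Rightarrow> 'g \<Rightarrow> bool" where
  "long k y \<longleftrightarrow> y \<in> carrier G \<and> (\<forall>i<k. r ((tail ^^ i) y) \<noteq> r \<one>)"

lemma long_closed: "long k y \<Longrightarrow> (tail ^^ k) y \<in> carrier G"
  by (induction k) (auto simp: long_def tail_closed)

lemma long_Suc: "long (Suc k) y \<longleftrightarrow> long k y \<and> r ((tail ^^ k) y) \<noteq> r \<one>"
  by (auto simp: long_def less_Suc_eq)

lemma rank_funpow_tail:
  assumes "long k y" "i \<le> k"
  shows "(r ((tail ^^ k) y), r ((tail ^^ i) y)) \<in> \<kappa>"
  using assms(2,1)
proof (induction k rule: dec_induct)
  case base
  then show ?case
    using long_closed rank_closed wo.REFL by (auto simp: refl_on_def)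
next
  case (step k)
  then have "(r (tail ((tail ^^ k) y)), r ((tail ^^ k) y)) \<in> pairs \<kappa>"
    using long_closed by (intro rank_tail) (auto simp: long_Suc)
  moreover have "(r ((tail ^^ k) y), r ((tail ^^ i) y)) \<in> \<kappa>"
    using step by (simp add: long_Suc)
  ultimately have "(r (tail ((tail ^^ k) y)), r ((tail ^^ i) y)) \<in> pairs \<kappa>"
    by (rule pairs_trans2)
  then show ?case by (simp add: pairs_def)
qed

lemma tails_terminate:
  assumes "y \<in> carrier G"
  shows "\<exists>k. long k y \<and> r ((tail ^^ k) y) = r \<one>"
proof -
  have wf: "wf (inv_image (pairs \<kappa>) r)" using wf_pairs by simp
  from wf assms show ?thesis
  proof (induction y rule: wf_induct_rule)
    case (less y)
    show ?case
    proof (cases "r y = r \<one>")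
      case True
      then show ?thesis using less.prems by (intro exI[of _ 0]) (simp add: long_def)
    next
      case False
      then obtain k where "long k (tail y)" "r ((tail ^^ k) (tail y)) = r \<one>"
        using less.IH[of "tail y"] less.prems rank_tail tail_closed by auto
      moreover from this have "long (Suc k) y"
        using False less.prems by (auto simp: long_def less_Suc_eq_0_disj funpow_swap1)
      ultimately show ?thesis by (intro exI[of _ "Suc k"]) (simp add: funpow_swap1)
    qed
  qed
qed

text \<open>This replaces the Delta-system lemma: at the first level where the iterated tail is constant on
  \<open>\<kappa>\<close> many elements, the fibres of the preceding level are still small.\<close>

lemma common_tail:
  assumes Y: "Y \<subseteq> carrier G" "|Y| =o \<kappa>"
  obtains k g Z where "Z \<subseteq> Y" "|Z| =o \<kappa>" "\<And>y. y \<in> Z \<Longrightarrow> long (Suc k) y"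
    "\<And>y. y \<in> Z \<Longrightarrow> (tail ^^ Suc k) y = g"
    "\<And>Z'. Z' \<subseteq> Z \<Longrightarrow> |Z'| =o \<kappa> \<Longrightarrow> |(\<lambda>y. r ((tail ^^ k) y)) ` Z'| =o \<kappa>"
proof -
  define F where "F k g = {y \<in> Y. long k y \<and> (tail ^^ k) y = g}" for k g
  define N where "N y = (SOME k. long k y \<and> r ((tail ^^ k) y) = r \<one>)" for y
  have N: "long (N y) y \<and> r ((tail ^^ N y) y) = r \<one>" if "y \<in> Y" for y
    unfolding N_def using someI_ex[OF tails_terminate] that Y(1) by blast
  obtain n where n: "|{y \<in> Y. N y = n}| =o \<kappa>"
    using pigeonhole[OF Y(2) small_countable[OF countableI_type], of N] by blast
  \<comment> \<open>After \<open>n\<close> steps all these elements reach the small set of rank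
    \<open>r \<one>\<close>, so \<open>\<kappa>\<close> many share their end \<open>g\<close> and
    some \<open>F n g\<close> is not small.\<close>
  have "(tail ^^ n) ` {y \<in> Y. N y = n} \<subseteq> {x \<in> carrier G. r x = r \<one>}"
    using N long_closed by auto
  then have "|(tail ^^ n) ` {y \<in> Y. N y = n}| <o \<kappa>" by (rule small_subset[OF _ rank_fibre])
  then obtain g where "|{y \<in> {y \<in> Y. N y = n}. (tail ^^ n) y = g}| =o \<kappa>"
    using pigeonhole[OF n] by blast
  moreover have "{y \<in> {y \<in> Y. N y = n}. (tail ^^ n) y = g} \<subseteq> F n g"
    using N by (auto simp: F_def)
  ultimately have "\<not> |F n g| <o \<kappa>" by (rule large_superset)
  then have ex: "\<exists>n. \<exists>g. \<not> |F n g| <o \<kappa>" by blast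
  define m where "m = (LEAST n. \<exists>g. \<not> |F n g| <o \<kappa>)"
  obtain g where g: "\<not> |F m g| <o \<kappa>" using LeastI_ex[OF ex] unfolding m_def by blast
  have least: "|F k h| <o \<kappa>" if "k < m" for k h
    using not_less_Least that unfolding m_def by blast
  \<comment> \<open>Level 0 has fibres with at most one element, so the least level \<open>m\<close>
    is a successor.\<close>
  have "F 0 g \<subseteq> {g}" by (auto simp: F_def)
  then have "|F 0 g| <o \<kappa>" by (intro small_countable) (simp add: countable_subset)
  then obtain k where k: "m = Suc k" using g by (cases m) auto
  have large: "|F m g| =o \<kappa>" by (rule large_subset[OF Y(2) _ g]) (auto simp: F_def)
  show ?thesis
  proof (rule that[of "F m g" k g])
    fix Z assume Z: "Z \<subseteq> F m g" "|Z| =o \<kappa>"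
    have Z_long: "long k y" "y \<in> Y" if "y \<in> Z" for y
      using Z(1) that by (auto simp: F_def k long_Suc)
    show "|(\<lambda>y. r ((tail ^^ k) y)) ` Z| =o \<kappa>"
    proof (rule large_image[OF Z(2)], rule ccontr)
      fix i
      let ?Z = "{y \<in> Z. r ((tail ^^ k) y) = i}"
      \<comment> \<open>The \<open>k\<close>-th tails of \<open>?Z\<close> lie in one small rank
        fibre, so \<open>\<kappa>\<close> many elements would share a tail \<open>h\<close> at level
        \<open>k\<close>, against the minimality of \<open>m\<close>.\<close>
      assume "\<not> |?Z| <o \<kappa>"
      then have "|?Z| =o \<kappa>" by (intro large_subset[OF Z(2)]) auto
      moreover have "(tail ^^ k) ` ?Z \<subseteq> {x \<in> carrier G. r x = i}"
        using Z_long long_closed by auto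
      then have "|(tail ^^ k) ` ?Z| <o \<kappa>" by (rule small_subset[OF _ rank_fibre])
      ultimately obtain h where "|{y \<in> ?Z. (tail ^^ k) y = h}| =o \<kappa>"
        using pigeonhole by blast
      moreover have "{y \<in> ?Z. (tail ^^ k) y = h} \<subseteq> F k h"
        using Z_long by (auto simp: F_def)
      ultimately show False
        using least[of k h] k large_superset by blast
    qed
  qed (use large in \<open>auto simp: F_def k\<close>)
qed

section \<open>The colouring of sums\<close>

lemma sum_colouring:
  fixes e :: "'a \<times> 'a \<Rightarrow> 'c" and T :: "'c set"
  assumes e: "e \<in> pairs \<kappa> \<rightarrow> T"
    and rectangle: "\<And>A B \<tau>. A \<subseteq> Field \<kappa> \<Longrightarrow> B \<subseteq> Field \<kappa> \<Longrightarrow> |A| =o \<kappa> \<Longrightarrow> |B| =o \<kappa> \<Longrightarrow> \<tau> \<in> T \<Longrightarrow>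
        \<exists>\<alpha>\<in>A. \<exists>\<beta>\<in>B. (\<alpha>, \<beta>) \<in> pairs \<kappa> \<and> e (\<alpha>, \<beta>) = \<tau>"
  obtains d where "d \<in> carrier G \<rightarrow> T"
    and "\<And>X Y \<tau>. X \<subseteq> carrier G \<Longrightarrow> Y \<subseteq> carrier G \<Longrightarrow> |X| =o \<kappa> \<Longrightarrow> |Y| =o \<kappa> \<Longrightarrow> \<tau> \<in> T \<Longrightarrow>
        \<exists>x\<in>X. \<exists>y\<in>Y. d (x \<otimes> y) = \<tau>"
proof -
  have "pairs \<kappa> \<noteq> {}" using rank_closed[OF one_closed] pairs_above by blast
  then have "T \<noteq> {}" using e by blast
  then obtain \<Psi> and q :: "'c list \<Rightarrow> nat" where \<Psi>: "\<And>us. set us \<subseteq> T \<Longrightarrow> \<Psi> us \<in> T"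
    and dominate: "\<And>m n \<tau>. \<tau> \<in> T \<Longrightarrow>
      \<exists>\<sigma>\<in>T. \<forall>us vs. set us \<subseteq> T \<longrightarrow> set vs \<subseteq> T \<longrightarrow> q us = m \<longrightarrow> q vs = n \<longrightarrow> \<Psi> (us @ \<sigma> # vs) = \<tau>"
    using dominating_colour by metis
  show ?thesis
  proof (rule that[of "\<lambda>x. \<Psi> (colours e x)"])
    show "(\<lambda>x. \<Psi> (colours e x)) \<in> carrier G \<rightarrow> T"
      using \<Psi> colours_closed[OF e] by blast
  next
    fix X Y \<tau>
    assume X: "X \<subseteq> carrier G" "|X| =o \<kappa>" and Y: "Y \<subseteq> carrier G" "|Y| =o \<kappa>" and \<tau>: "\<tau> \<in> T"
    obtain k g Z where Z: "Z \<subseteq> Y" "|Z| =o \<kappa>" and Z_long: "\<And>y. y \<in> Z \<Longrightarrow> long (Suc k) y"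
      and Z_tail: "\<And>y. y \<in> Z \<Longrightarrow> (tail ^^ Suc k) y = g"
      and Z_ranks: "\<And>Z'. Z' \<subseteq> Z \<Longrightarrow> |Z'| =o \<kappa> \<Longrightarrow> |(\<lambda>y. r ((tail ^^ k) y)) ` Z'| =o \<kappa>"
      using common_tail[OF Y] by metis
    have "Z \<noteq> {}" using Z(2) small_countable[OF countable_empty] large_not_small by blast
    then have g: "g \<in> carrier G" using Z_long Z_tail long_closed by blast
    \<comment> \<open>\<open>q\<close> has only countably many values, so it becomes constant on
      \<open>\<kappa>\<close> many elements; the same is done for \<open>X\<close>.\<close>
    obtain m where m: "|{y \<in> Z. q (head_colours e k y) = m}| =o \<kappa>"
      using pigeonhole[OF Z(2) small_countable[OF countableI_type], of "\<lambda>y. q (head_colours e k y)"] by blast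
    obtain n where n: "|{x \<in> X. q (colours e (x \<otimes> g)) = n}| =o \<kappa>"
      using pigeonhole[OF X(2) small_countable[OF countableI_type], of "\<lambda>x. q (colours e (x \<otimes> g))"] by blast
    define Y' where "Y' = {y \<in> Z. q (head_colours e k y) = m}"
    define X' where "X' = {x \<in> X. q (colours e (x \<otimes> g)) = n}"
    \<comment> \<open>The junction pair consists of the rank of \<open>x \<otimes> g\<close> and of
      the last rank of \<open>y\<close> before \<open>g\<close>; \<open>A\<close> and
      \<open>B\<close> collect these.\<close>
    define B where "B = (\<lambda>y. r ((tail ^^ k) y)) ` Y'"
    define A where "A = (\<lambda>x. r (x \<otimes> g)) ` X'"
    have B: "B \<subseteq> Field \<kappa>" "|B| =o \<kappa>"
      using Z_ranks[of Y'] m rank_closed long_closed Z_long by (auto simp: B_def Y'_def long_Suc)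
    have "A \<subseteq> Field \<kappa>" using rank_closed X g by (auto simp: A_def X'_def)
    moreover have "|A| =o \<kappa>"
      unfolding A_def
    proof (rule large_image)
      show "|X'| =o \<kappa>" using n by (simp add: X'_def)
      fix i
      \<comment> \<open>Translation by \<open>inv g\<close> carries a rank fibre onto a set
        containing this fibre.\<close>
      have "{x \<in> X'. r (x \<otimes> g) = i} \<subseteq> (\<lambda>z. z \<otimes> inv g) ` {z \<in> carrier G. r z = i}"
      proof
        fix x assume x: "x \<in> {x \<in> X'. r (x \<otimes> g) = i}"
        then have "x \<in> carrier G" using X by (auto simp: X'_def)
        then have "x = (x \<otimes> g) \<otimes> inv g" "x \<otimes> g \<in> carrier G" using g by (simp_all add: m_assoc)
        then show "x \<in> (\<lambda>z. z \<otimes> inv g) ` {z \<in> carrier G. r z = i}" using x by blast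
      qed
      then show "|{x \<in> X'. r (x \<otimes> g) = i}| <o \<kappa>"
        by (rule small_subset[OF _ small_image[OF rank_fibre]])
    qed
    \<comment> \<open>The colour wanted at the junction depends only on \<open>m\<close>,
      \<open>n\<close> and \<open>\<tau>\<close>, so it is fixed before \<open>x\<close> and
      \<open>y\<close> are found.\<close>
    moreover obtain \<sigma> where \<sigma>: "\<sigma> \<in> T" "\<And>us vs. set us \<subseteq> T \<Longrightarrow> set vs \<subseteq> T \<Longrightarrow> q us = m \<Longrightarrow> q vs = n \<Longrightarrow>
        \<Psi> (us @ \<sigma> # vs) = \<tau>"
      using dominate[OF \<tau>, of m n] by blast
    ultimately obtain \<alpha> \<beta> where "\<alpha> \<in> A" "\<beta> \<in> B" and less: "(\<alpha>, \<beta>) \<in> pairs \<kappa>" and "e (\<alpha>, \<beta>) = \<sigma>"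
      using rectangle B by blast
    then obtain x y where x: "x \<in> X'" "\<alpha> = r (x \<otimes> g)" and y: "y \<in> Y'" "\<beta> = r ((tail ^^ k) y)"
      by (auto simp: A_def B_def)
    have xG: "x \<in> carrier G" "x \<in> X" using x X by (auto simp: X'_def)
    have yZ: "y \<in> Z" "y \<in> Y" "y \<in> carrier G" using y Z Y by (auto simp: Y'_def)
    have k: "long k y" "r ((tail ^^ k) y) \<noteq> r \<one>" using Z_long yZ by (auto simp: long_Suc)
    \<comment> \<open>\<open>g\<close> is the tail of \<open>(tail ^^ k) y\<close>, hence of rank
      below \<open>\<beta>\<close>. As \<open>x \<otimes> g\<close> has rank \<open>\<alpha>\<close>
      below \<open>\<beta>\<close>, so has \<open>x\<close>, which \<open>colours_mult\<close>
      requires.\<close>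
    have "(r g, \<beta>) \<in> pairs \<kappa>"
      using rank_tail[OF long_closed k(2)] k(1) Z_tail[OF yZ(1)] by (simp add: y(2))
    then have "(r ((x \<otimes> g) \<otimes> inv g), \<beta>) \<in> pairs \<kappa>"
      using less x(2) xG g rank_inv by (intro rank_mult[of "x \<otimes> g" "inv g"]) auto
    moreover have "(x \<otimes> g) \<otimes> inv g = x" using xG g by (simp add: m_assoc)
    ultimately have "(r x, \<beta>) \<in> pairs \<kappa>" by simp
    \<comment> \<open>\<open>\<beta>\<close> is the least rank among the iterates up to
      \<open>k\<close>.\<close>
    then have "(r x, r ((tail ^^ i) y)) \<in> pairs \<kappa>" if "i \<le> k" for i
      using pairs_trans2 rank_funpow_tail[OF k(1) that] y(2) by blast
    from colours_mult[OF xG(1) yZ(3) this, of k e]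
    have "colours e (x \<otimes> y) = head_colours e k y @ \<sigma> # colours e (x \<otimes> g)"
      using Z_tail[OF yZ(1)] x(2) y(2) \<open>e (\<alpha>, \<beta>) = \<sigma>\<close> by simp
    moreover have "set (head_colours e k y) \<subseteq> T"
      using k(1) yZ(3) by (intro head_colours_closed[OF e]) (auto simp: long_def)
    ultimately have "\<Psi> (colours e (x \<otimes> y)) = \<tau>"
      using \<sigma>(2) colours_closed[OF e] x y by (simp add: X'_def Y'_def)
    then show "\<exists>x\<in>X. \<exists>y\<in>Y. \<Psi> (colours e (x \<otimes> y)) = \<tau>" using xG yZ by blast
  qed
qed

end

section \<open>An Abelian group of prescribed size, and the equivalence\<close>

text \<open>The free Abelian group on an infinite \<open>A\<close> has size \<open>|A|\<close>; its
  carrier lies in another type and is transported along an injection into \<open>'g\<close>.\<close>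

lemma comm_group_exists:
  assumes "infinite A" "|A| \<le>o |UNIV :: 'g set|"
  obtains G :: "'g monoid" where "comm_group G" "|carrier G| =o |A|"
proof -
  obtain h :: "_ \<Rightarrow> 'g" where h: "inj_on h A"
    using assms(2) unfolding card_of_ordLeq[symmetric] by blast
  let ?F = "free_Abelian_group A"
  obtain b where b: "bij_betw b (carrier ?F) A"
    using eqpoll_free_Abelian_group_infinite[OF assms(1)] by (auto simp: eqpoll_def)
  let ?f = "h \<circ> b"
  have f: "inj_on ?f (carrier ?F)"
    using h b by (auto simp: bij_betw_def intro: comp_inj_on)
  interpret F: comm_group ?F by (rule abelian_free_Abelian_group)
  show ?thesis
  proof (rule that)
    have "?F \<cong> image_group ?f ?F"
      using inj_imp_image_group_iso[OF f] by (auto simp: is_iso_def)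
    then show "comm_group (image_group ?f ?F)"
      using F.iso_imp_comm_group F.inj_imp_image_group_is_group[OF f] group.is_monoid by blast
    have "|carrier ?F| =o |carrier (image_group ?f ?F)|"
      using f card_of_ordIsoI inj_on_imp_bij_betw by (metis image_group_carrier)
    moreover have "|carrier ?F| =o |A|" using b card_of_ordIsoI by blast
    ultimately show "|carrier (image_group ?f ?F)| =o |A|"
      using ordIso_symmetric ordIso_transitive by blast
  qed
qed

(* The group carriers live in an arbitrary type 'g. The last assumption only says that 'g has room
   for a set of size \<kappa>; it holds automatically for 'g = 'a. *)
theorem theoremA:
  fixes \<kappa> :: "'a rel" and \<theta> :: "'b rel"
  assumes "Card_order \<kappa>" and "regularCard \<kappa>" and "natLeq <o \<kappa>"
    and "Card_order \<theta>" and "\<theta> \<le>o \<kappa>"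
    and "Pl1 \<kappa>"
    and "\<kappa> \<le>o |UNIV :: 'g set|"
  shows
    "(\<exists>c \<in> pairs \<kappa> \<rightarrow> Field \<theta>. \<forall>X \<subseteq> Field \<kappa>. |X| =o \<kappa> \<longrightarrow>
        (\<forall>\<tau> \<in> Field \<theta>. \<exists>x\<in>X. \<exists>y\<in>X. (x, y) \<in> pairs \<kappa> \<and> c (x, y) = \<tau>))
     \<longleftrightarrow>
     (\<forall>G :: 'g monoid. comm_group G \<longrightarrow> |carrier G| =o \<kappa> \<longrightarrow>
        (\<exists>c \<in> carrier G \<rightarrow> Field \<theta>. \<forall>X \<subseteq> carrier G. \<forall>Y \<subseteq> carrier G.
           |X| =o \<kappa> \<longrightarrow> |Y| =o \<kappa> \<longrightarrow>
           (\<forall>\<tau> \<in> Field \<theta>. \<exists>x\<in>X. \<exists>y\<in>Y. c (x \<otimes>\<^bsub>G\<^esub> y) = \<tau>)))"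
    (is "?square \<longleftrightarrow> ?sum")
proof -
  interpret regular_uncountable \<kappa>
    by (rule regular_uncountable.intro) (fact assms)+
  show ?thesis
  proof
    assume ?square
    then obtain c where c: "c \<in> pairs \<kappa> \<rightarrow> Field \<theta>"
      and square: "\<forall>X \<subseteq> Field \<kappa>. |X| =o \<kappa> \<longrightarrow>
        (\<forall>\<tau> \<in> Field \<theta>. \<exists>x\<in>X. \<exists>y\<in>X. (x, y) \<in> pairs \<kappa> \<and> c (x, y) = \<tau>)"
      by (rule bexE)
    obtain e where e: "e \<in> pairs \<kappa> \<rightarrow> Field \<theta>"
      and rectangle: "\<And>A B \<tau>. A \<subseteq> Field \<kappa> \<Longrightarrow> B \<subseteq> Field \<kappa> \<Longrightarrow> |A| =o \<kappa> \<Longrightarrow> |B| =o \<kappa> \<Longrightarrow> \<tau> \<in> Field \<theta> \<Longrightarrow>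
        \<exists>\<alpha>\<in>A. \<exists>\<beta>\<in>B. (\<alpha>, \<beta>) \<in> pairs \<kappa> \<and> e (\<alpha>, \<beta>) = \<tau>"
      by (rule rectangular_colouring[OF assms(6) c square[rule_format]]) (assumption | rule that)+
    show ?sum
    proof (intro allI impI)
      fix G :: "'g monoid"
      assume G: "comm_group G" "|carrier G| =o \<kappa>"
      interpret G: comm_group G by (rule G(1))
      obtain r where r: "r \<in> carrier G \<rightarrow> Field \<kappa>"
        "\<And>x y i. x \<in> carrier G \<Longrightarrow> y \<in> carrier G \<Longrightarrow> (r x, i) \<in> pairs \<kappa> \<Longrightarrow> (r y, i) \<in> pairs \<kappa>
           \<Longrightarrow> (r (x \<otimes>\<^bsub>G\<^esub> y), i) \<in> pairs \<kappa>"
        "\<And>x i. x \<in> carrier G \<Longrightarrow> (r x, i) \<in> pairs \<kappa> \<Longrightarrow> (r (inv\<^bsub>G\<^esub> x), i) \<in> pairs \<kappa>"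
        "\<And>i. |{x \<in> carrier G. r x = i}| <o \<kappa>"
        by (rule rank_exists[OF G.is_group G(2)]) (assumption | rule that)+
      interpret ranked_group \<kappa> G r
        by unfold_locales (use r in auto)
      obtain d where d: "d \<in> carrier G \<rightarrow> Field \<theta>"
        and d_hits: "\<And>X Y \<tau>. X \<subseteq> carrier G \<Longrightarrow> Y \<subseteq> carrier G \<Longrightarrow> |X| =o \<kappa> \<Longrightarrow> |Y| =o \<kappa> \<Longrightarrow> \<tau> \<in> Field \<theta> \<Longrightarrow>
          \<exists>x\<in>X. \<exists>y\<in>Y. d (x \<otimes>\<^bsub>G\<^esub> y) = \<tau>"
        by (rule sum_colouring[OF e rectangle]) (assumption | rule that)+
      show "\<exists>c \<in> carrier G \<rightarrow> Field \<theta>. \<forall>X \<subseteq> carrier G. \<forall>Y \<subseteq> carrier G.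
           |X| =o \<kappa> \<longrightarrow> |Y| =o \<kappa> \<longrightarrow>
           (\<forall>\<tau> \<in> Field \<theta>. \<exists>x\<in>X. \<exists>y\<in>Y. c (x \<otimes>\<^bsub>G\<^esub> y) = \<tau>)"
        by (intro bexI[of _ d] allI impI ballI d_hits d)
    qed
  next
    assume sum: ?sum
    \<comment> \<open>The hypothesis speaks of groups inside \<open>'g\<close>, so one of size
      \<open>\<kappa>\<close> has to be found there.\<close>
    have "|Field \<kappa>| \<le>o |UNIV :: 'g set|"
      using assms(7) large_Field ordIso_ordLeq_trans by blast
    then obtain G :: "'g monoid" where "comm_group G" "|carrier G| =o |Field \<kappa>|"
      by (rule comm_group_exists[OF infinite_Field])
    then have G: "comm_group G" "|carrier G| =o \<kappa>"
      using large_Field ordIso_transitive by blast+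
    interpret comm_group G by fact
    obtain c where c: "c \<in> carrier G \<rightarrow> Field \<theta>"
      and hit: "\<forall>X \<subseteq> carrier G. \<forall>Y \<subseteq> carrier G. |X| =o \<kappa> \<longrightarrow> |Y| =o \<kappa> \<longrightarrow>
        (\<forall>\<tau> \<in> Field \<theta>. \<exists>x\<in>X. \<exists>y\<in>Y. c (x \<otimes>\<^bsub>G\<^esub> y) = \<tau>)"
      using sum[THEN spec, THEN mp, OF G(1), THEN mp, OF G(2)] by (rule bexE)
    obtain f where f: "bij_betw f (Field \<kappa>) (carrier G)"
      using large_bij large_Field G(2) by metis
    have fG: "f \<alpha> \<in> carrier G" if "\<alpha> \<in> Field \<kappa>" for \<alpha>
      using f that bij_betwE by blast
    let ?c = "\<lambda>(\<alpha>, \<beta>). c (f \<alpha> \<otimes>\<^bsub>G\<^esub> f \<beta>)"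
    show ?square
    proof (intro bexI[of _ ?c] allI impI ballI)
      show "?c \<in> pairs \<kappa> \<rightarrow> Field \<theta>"
        using c fG pairs_Field by (fastforce simp: Pi_iff)
    next
      fix X \<tau> assume X: "X \<subseteq> Field \<kappa>" "|X| =o \<kappa>" and \<tau>: "\<tau> \<in> Field \<theta>"
      \<comment> \<open>Disjoint halves make the two elements found distinct.\<close>
      obtain B C where BC: "B \<subseteq> X" "C \<subseteq> X" "B \<inter> C = {}" "|B| =o \<kappa>" "|C| =o \<kappa>"
        using large_halves X(2) by metis
      have inj: "inj_on f B" "inj_on f C"
        using BC X f inj_on_subset[of f "Field \<kappa>"] by (simp_all add: bij_betw_def subset_trans)
      have "f ` B \<subseteq> carrier G" "f ` C \<subseteq> carrier G" using fG BC X by auto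
      from hit[rule_format, OF this large_image_inj[OF BC(4) inj(1)] large_image_inj[OF BC(5) inj(2)] \<tau>]
      obtain \<alpha> \<beta> where \<alpha>\<beta>: "\<alpha> \<in> B" "\<beta> \<in> C" "c (f \<alpha> \<otimes>\<^bsub>G\<^esub> f \<beta>) = \<tau>" by blast
      then have X\<alpha>\<beta>: "\<alpha> \<in> X" "\<beta> \<in> X" "\<alpha> \<noteq> \<beta>" using BC by auto
      then have "(\<alpha>, \<beta>) \<in> pairs \<kappa> \<or> (\<beta>, \<alpha>) \<in> pairs \<kappa>" using pairs_linear X by blast
      \<comment> \<open>Commutativity gives the same colour whichever of the two elements comes
        first.\<close>
      moreover have "?c (\<alpha>, \<beta>) = \<tau>" "?c (\<beta>, \<alpha>) = \<tau>"
        using \<alpha>\<beta> X\<alpha>\<beta> X fG m_comm by (auto simp: subset_iff)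
      ultimately show "\<exists>x\<in>X. \<exists>y\<in>X. (x, y) \<in> pairs \<kappa> \<and> ?c (x, y) = \<tau>"
        using X\<alpha>\<beta> by blast
    qed
  qed
qed

end
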